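(* Let $0<\alpha<1$ and let $\omega_m$, $m\ge0$, be the weights defined by $$\sum_{m=0}^{\infty}\omega_m\xi^m=\left[\frac{1-\xi}{\frac12(1+\xi)+\frac1{2\alpha}(1-\xi)}\right]^\alpha .$$ Then: (i) $\omega_0>0$ and $\omega_m<0$ for all $m\ge1$; (ii) $\omega_m>\omega_{m-1}$ for all $m\ge2$; (iii) $\sum_{m=0}^{n}\omega_m>0$ for every $n\ge0$.
   Context: The $\omega_m$ are the weights of the shifted fractional trapezoidal rule with shift $\frac12$ (SFTR-$\frac12$). Equivalently, they are given by the recursion $$\omega_0=\Big(\frac{2\alpha}{\alpha+1}\Big)^{\alpha},\qquad \omega_1=-\alpha\Big(\frac{2\alpha}{\alpha+1}\Big)^{\alpha+1},$$ $$\omega_m=\frac{2\alpha}{m(\alpha+1)}\left\{\Big[\frac1\alpha(m-1)-\alpha\Big]\omega_{m-1}+\frac{\alpha-1}{2\alpha}(m-2)\,\omega_{m-2}\right\},\quad m\ge2.$$ *)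

theory Defs
  imports "HOL-Analysis.Analysis"
begin

lemma binomial_real_has_fps_expansion:
  fixes a t :: real
  assumes "\<bar>t\<bar> \<le> 1"
  shows "(\<lambda>x. (1 + t * x) powr a) has_fps_expansion Abs_fps (\<lambda>n. (a gchoose n) * t ^ n)"
proof (rule has_fps_expansionI)
  have "(\<lambda>n. fps_nth (Abs_fps (\<lambda>n. (a gchoose n) * t ^ n)) n * u ^ n) sums (1 + t * u) powr a"
    if "u \<in> ball 0 1" for u :: real
  proof -
    have "\<bar>t * u\<bar> < 1"
      using assms that mult_left_le_one_le[of "\<bar>u\<bar>" "\<bar>t\<bar>"] by (simp add: abs_mult)
    from gen_binomial_real[OF this, of a] show ?thesis
      by (simp add: power_mult_distrib mult_ac)
  qed
  moreover have "eventually (\<lambda>u::real. u \<in> ball 0 1) (nhds 0)"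
    by (intro eventually_nhds_in_open) auto
  ultimately show "\<forall>\<^sub>F u in nhds 0. (\<lambda>n. fps_nth (Abs_fps (\<lambda>n. (a gchoose n) * t ^ n)) n * u ^ n)
      sums (1 + t * u) powr a"
    by (auto elim: eventually_mono)
qed

lemma real_has_fps_expansion_unique:
  fixes F G :: "real fps"
  assumes "f has_fps_expansion F" and "f has_fps_expansion G"
  shows "F = G"
proof (rule ccontr)
  assume "F \<noteq> G"
  define H where "H = F - G"
  define n where "n = subdegree H"
  from \<open>F \<noteq> G\<close> have nz: "fps_nth H n \<noteq> 0"
    unfolding n_def by (intro nth_subdegree_nonzero) (simp add: H_def)
  have "(\<lambda>x. f x - f x) has_fps_expansion H"
    unfolding H_def by (intro has_fps_expansion_diff assms)
  hence "(\<lambda>x::real. 0) has_fps_expansion H"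
    by simp
  hence "(\<lambda>x::real. if x = 0 then fps_nth H n else 0 / x ^ n) has_fps_expansion fps_shift n H"
    by (rule has_fps_expansion_shift) (simp_all add: n_def)
  hence "isCont (\<lambda>x::real. if x = 0 then fps_nth H n else 0 / x ^ n) 0"
    by (rule has_fps_expansion_imp_continuous)
  hence "((\<lambda>x::real. if x = 0 then fps_nth H n else 0 / x ^ n) \<longlongrightarrow> fps_nth H n) (at 0)"
    by (simp add: isCont_def)
  moreover have "((\<lambda>x::real. if x = 0 then fps_nth H n else 0 / x ^ n) \<longlongrightarrow> 0) (at 0)"
    by (rule tendsto_eventually) (simp add: eventually_at_filter)
  ultimately have "fps_nth H n = 0"
    by (rule tendsto_unique[rotated]) simp
  with nz show False ..
qed

text \<open>
  The generating function, viewed as a real function near the origin, determines the weights;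
  has_fps_expansion includes a positive radius of convergence. Near the origin the base of the
  power is positive, so powr is the ordinary real power there.
\<close>

lemma sftr_weights_exist1:
  fixes \<alpha> :: real
  assumes "0 < \<alpha>" and "\<alpha> < 1"
  shows "\<exists>!\<omega> :: nat \<Rightarrow> real.
    (\<lambda>\<xi>. ((1 - \<xi>) / (1/2 * (1 + \<xi>) + 1/(2*\<alpha>) * (1 - \<xi>))) powr \<alpha>) has_fps_expansion Abs_fps \<omega>"
    (is "\<exists>!\<omega>. ?g has_fps_expansion _")
proof -
  define c where "c = 2 * \<alpha> / (\<alpha> + 1)"
  define d where "d = (1 - \<alpha>) / (1 + \<alpha>)"
  define F where "F = fps_const (c powr \<alpha>) * (Abs_fps (\<lambda>n. (\<alpha> gchoose n) * (-1) ^ n) *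
                        Abs_fps (\<lambda>n. ((-\<alpha>) gchoose n) * (-d) ^ n))"
  have c: "c > 0" and d: "0 < d" "d < 1"
    using assms by (auto simp: c_def d_def field_simps)
  let ?h = "\<lambda>x. c powr \<alpha> * ((1 + (-1) * x) powr \<alpha> * (1 + (-d) * x) powr (-\<alpha>))"
  have "?h has_fps_expansion F"
    unfolding F_def using d
    by (intro has_fps_expansion_cmult_left has_fps_expansion_mult binomial_real_has_fps_expansion) auto
  moreover have "eventually (\<lambda>x. ?h x = ?g x) (nhds 0)"
  proof -
    have "eventually (\<lambda>x::real. x \<in> ball 0 1) (nhds 0)"
      by (intro eventually_nhds_in_open) auto
    thus ?thesis
    proof eventually_elim
      case (elim x)
      hence x: "-1 < x" "x < 1" by auto
      have "d * x \<le> d * 1"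
        using x d by (intro mult_left_mono) auto
      with d have dx: "1 - d * x > 0"
        by linarith
      have eq: "1/2 * (1 + x) + 1/(2*\<alpha>) * (1 - x) = (1 - d * x) / c"
        using assms by (simp add: c_def d_def divide_simps) (simp add: algebra_simps)
      have "?g x = (c * (1 - x) / (1 - d * x)) powr \<alpha>"
        unfolding eq by (simp add: mult.commute)
      also have "\<dots> = ?h x"
        using c x dx by (simp add: powr_mult powr_divide powr_minus_divide)
      finally show ?case ..
    qed
  qed
  ultimately have "?g has_fps_expansion F"
    unfolding has_fps_expansion_def by (auto elim: eventually_elim2)
  moreover have "Abs_fps (fps_nth F) = F"
    by (simp add: fps_eq_iff)
  ultimately have ex: "?g has_fps_expansion Abs_fps (fps_nth F)"
    by (simp only:)
  show ?thesis
  proof (rule ex1I[of _ "fps_nth F"])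
    show "?g has_fps_expansion Abs_fps (fps_nth F)"
      by (rule ex)
  next
    fix \<omega> assume "?g has_fps_expansion Abs_fps \<omega>"
    from real_has_fps_expansion_unique[OF this ex] show "\<omega> = fps_nth F"
      by (simp add: fps_eq_iff fun_eq_iff)
  qed
qed

end

theory Submission
  imports Defs
begin

text \<open>
  With \<open>d = (1 - \<alpha>) / (1 + \<alpha>)\<close>, the generating function is a positive multiple of
  \<open>G = (1 - x)\<^sup>\<alpha> (1 - d x)\<^sup>-\<^sup>\<alpha>\<close>. The three claims say that all coefficients of the power series
  \<open>-G'\<close>, \<open>((1 - x) G)''\<close> and \<open>G / (1 - x)\<close> are positive. Each of them turns out to be a
  positive multiple of a product of negative powers of \<open>1 - x\<close> and \<open>1 - d x\<close>; for the second
  one this is because the three terms of the Leibniz rule combine to the perfect square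
  \<open>((1 - d x) - d (1 - x))\<^sup>2 = (1 - d)\<^sup>2\<close>.
\<close>

text \<open>The binomial series of \<open>(1 - s * x) powr b\<close>, given by its coefficients so
  that identities between exponents can be proved formally.\<close>

definition fps_lin_powr :: "real \<Rightarrow> real \<Rightarrow> real fps" where
  "fps_lin_powr s b = Abs_fps (\<lambda>n. (b gchoose n) * (- s) ^ n)"

lemma fps_lin_powr_nth: "fps_nth (fps_lin_powr s b) n = (b gchoose n) * (- s) ^ n"
  by (simp add: fps_lin_powr_def)

text \<open>Pascal's rule for \<open>gchoose\<close>. It serves to reduce products to a common
  lowest exponent.\<close>

lemma fps_lin_powr_add_1:
  "fps_lin_powr s (b + 1) = (1 - fps_const s * fps_X) * fps_lin_powr s b"
proof (rule fps_ext)
  fix n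
  show "fps_nth (fps_lin_powr s (b + 1)) n =
        fps_nth ((1 - fps_const s * fps_X) * fps_lin_powr s b) n"
  proof (cases n)
    case (Suc k)
    then show ?thesis
      by (simp add: fps_lin_powr_nth gbinomial_Suc_Suc left_diff_distrib mult.assoc)
        (simp add: algebra_simps)
  qed (simp add: fps_lin_powr_nth left_diff_distrib mult.assoc)
qed

lemma fps_deriv_lin_powr:
  "fps_deriv (fps_lin_powr s b) = fps_const (- s * b) * fps_lin_powr s (b - 1)"
proof (rule fps_ext)
  fix n
  have "(real n + 1) * (b gchoose Suc n) = b * (b - 1 gchoose n)"
    using gbinomial_absorption[of n b] by (simp add: add.commute)
  then show "fps_nth (fps_deriv (fps_lin_powr s b)) n =
        fps_nth (fps_const (- s * b) * fps_lin_powr s (b - 1)) n"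
    by (simp add: fps_lin_powr_nth add.commute)
qed

text \<open>The sign \<open>(-1) ^ n\<close> of \<open>b gchoose n\<close> cancels against that of
  \<open>(- s) ^ n\<close>, leaving a rising factorial of \<open>- b > 0\<close>.\<close>

lemma fps_lin_powr_nth_pos:
  assumes "s > 0" "b < 0"
  shows "fps_nth (fps_lin_powr s b) n > 0"
proof -
  have "fps_nth (fps_lin_powr s b) n = pochhammer (- b) n * s ^ n / fact n"
    unfolding fps_lin_powr_nth gbinomial_pochhammer power_minus[of s n]
    by (simp add: left_minus_one_mult_self)
  with assms show ?thesis
    by (simp add: pochhammer_pos)
qed

lemma fps_mult_nth_pos:
  fixes A B :: "real fps"
  assumes "\<And>n. fps_nth A n > 0" "\<And>n. fps_nth B n > 0"
  shows "fps_nth (A * B) n > 0"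
  unfolding fps_mult_nth using assms by (intro sum_pos) auto

text \<open>After the lowest powers are factored out of the product rule, the bracket
  \<open>d (1 - X) - (1 - d X)\<close> remains, in which \<open>X\<close> cancels.\<close>

lemma fps_deriv_lin_powr_prod:
  "fps_deriv (fps_lin_powr 1 a * fps_lin_powr d (- a)) =
   fps_const (- a * (1 - d)) * (fps_lin_powr 1 (a - 1) * fps_lin_powr d (- a - 1))"
proof -
  have U: "fps_lin_powr 1 a = (1 - fps_X) * fps_lin_powr 1 (a - 1)"
    using fps_lin_powr_add_1[of 1 "a - 1"] by simp
  have V: "fps_lin_powr d (- a) = (1 - fps_const d * fps_X) * fps_lin_powr d (- a - 1)"
    using fps_lin_powr_add_1[of d "- a - 1"] by simp
  \<comment> \<open>Constants are split into \<open>fps_const a\<close> and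
    \<open>fps_const d\<close>, which \<open>algebra\<close> can then treat as ring
    variables.\<close>
  have const_simps:
    "fps_const (- 1 * a) = - fps_const a"
    "fps_const (- d * - a) = fps_const d * fps_const a"
    "fps_const (- a * (1 - d)) = - fps_const a * (1 - fps_const d)"
    by (simp_all flip: fps_const_1_eq_1)
  show ?thesis
    unfolding fps_deriv_mult fps_deriv_lin_powr const_simps unfolding U V by algebra
qed

text \<open>The exponents \<open>a + 1\<close> and \<open>- a\<close> give all three Leibniz terms
  the same factor \<open>a * (a + 1)\<close>; this is what lets the rest form a square.\<close>

lemma fps_deriv2_lin_powr_prod:
  "fps_deriv (fps_deriv (fps_lin_powr 1 (a + 1) * fps_lin_powr d (- a))) =
   fps_const (a * (a + 1) * (1 - d)\<^sup>2) * (fps_lin_powr 1 (a - 1) * fps_lin_powr d (- a - 2))"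
proof -
  have exps: "a + 1 - 1 = a" "- a - 1 - 1 = - a - 2" "- a - 2 + 1 = - a - 1" "- a - 1 + 1 = - a"
    by simp_all
  have U1: "fps_lin_powr 1 a = (1 - fps_X) * fps_lin_powr 1 (a - 1)"
    using fps_lin_powr_add_1[of 1 "a - 1"] by simp
  have U2: "fps_lin_powr 1 (a + 1) = (1 - fps_X)\<^sup>2 * fps_lin_powr 1 (a - 1)"
    using fps_lin_powr_add_1[of 1 a] U1 by (simp add: power2_eq_square mult.assoc)
  have V1: "fps_lin_powr d (- a - 1) = (1 - fps_const d * fps_X) * fps_lin_powr d (- a - 2)"
    using fps_lin_powr_add_1[of d "- a - 2"] unfolding exps .
  have V2: "fps_lin_powr d (- a) = (1 - fps_const d * fps_X)\<^sup>2 * fps_lin_powr d (- a - 2)"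
    using fps_lin_powr_add_1[of d "- a - 1"] unfolding exps V1 power2_eq_square mult.assoc .
  have const_simps:
    "fps_const (- 1 * (a + 1)) = - (fps_const a + 1)"
    "fps_const (- 1 * a) = - fps_const a"
    "fps_const (- d * - a) = fps_const d * fps_const a"
    "fps_const (- d * (- a - 1)) = fps_const d * (fps_const a + 1)"
    "fps_const (a * (a + 1) * (1 - d)\<^sup>2) =
       fps_const a * (fps_const a + 1) * (1 - fps_const d)\<^sup>2"
    by (simp_all add: power2_eq_square algebra_simps flip: fps_const_1_eq_1)
  show ?thesis
    unfolding fps_deriv_mult fps_deriv_add fps_deriv_lin_powr fps_deriv_const exps
    unfolding const_simps U1 U2 V1 V2 by algebra
qed

lemma fps_lin_powr_expansion:
  assumes "\<bar>s\<bar> \<le> 1"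
  shows "(\<lambda>x. (1 - s * x) powr b) has_fps_expansion fps_lin_powr s b"
  using binomial_real_has_fps_expansion[of "- s" b] assms by (simp add: fps_lin_powr_def)

lemma sftr_fps_expansion:
  fixes \<alpha> :: real
  assumes "0 < \<alpha>" "\<alpha> < 1"
  defines "d \<equiv> (1 - \<alpha>) / (1 + \<alpha>)"
  shows "(\<lambda>\<xi>. ((1 - \<xi>) / (1/2 * (1 + \<xi>) + 1/(2*\<alpha>) * (1 - \<xi>))) powr \<alpha>) has_fps_expansion
    fps_const ((1 - d) powr \<alpha>) * (fps_lin_powr 1 \<alpha> * fps_lin_powr d (- \<alpha>))"
    (is "?g has_fps_expansion ?F")
proof -
  have d: "0 < d" "d < 1"
    using assms by (auto simp: d_def field_simps)
  let ?h = "\<lambda>x. (1 - d) powr \<alpha> * ((1 - 1 * x) powr \<alpha> * (1 - d * x) powr (- \<alpha>))"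
  have "?h has_fps_expansion ?F"
    using d by (intro has_fps_expansion_cmult_left has_fps_expansion_mult fps_lin_powr_expansion) auto
  moreover have "eventually (\<lambda>x. ?h x = ?g x) (nhds 0)"
  proof -
    have "eventually (\<lambda>x::real. x \<in> ball 0 1) (nhds 0)"
      by (intro eventually_nhds_in_open) auto
    thus ?thesis
    proof eventually_elim
      case (elim x)
      hence x: "-1 < x" "x < 1" by auto
      \<comment> \<open>Positivity of \<open>1 - x\<close> and \<open>1 - d * x\<close> near the
        origin allows \<open>powr\<close> to be split over the quotient.\<close>
      have "d * x \<le> d"
        using x d mult_left_mono[of x 1 d] by simp
      with d have dx: "1 - d * x > 0"
        by linarith
      have c: "1 - d = 2 * \<alpha> / (1 + \<alpha>)"
        using assms by (simp add: d_def field_simps)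
      have eq: "1/2 * (1 + x) + 1/(2*\<alpha>) * (1 - x) = (1 - d * x) / (1 - d)"
        unfolding c using assms by (simp add: d_def divide_simps) (simp add: algebra_simps)
      have "?g x = ((1 - d) * (1 - x) / (1 - d * x)) powr \<alpha>"
        unfolding eq by (simp add: mult.commute)
      also have "\<dots> = ?h x"
        using d x dx by (simp add: powr_mult powr_divide powr_minus_divide)
      finally show ?case ..
    qed
  qed
  ultimately show ?thesis
    unfolding has_fps_expansion_def by (auto elim: eventually_elim2)
qed

theorem lemma2:
  fixes \<alpha> :: real and \<omega> :: "nat \<Rightarrow> real"
  assumes "0 < \<alpha>" and "\<alpha> < 1"
    and "(\<lambda>\<xi>. ((1 - \<xi>) / (1/2 * (1 + \<xi>) + 1/(2*\<alpha>) * (1 - \<xi>))) powr \<alpha>)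
           has_fps_expansion Abs_fps \<omega>"
  shows "(\<omega> 0 > 0 \<and> (\<forall>m\<ge>1. \<omega> m < 0)) \<and>
         (\<forall>m\<ge>2. \<omega> m > \<omega> (m - 1)) \<and>
         (\<forall>n. (\<Sum>m=0..n. \<omega> m) > 0)"
proof -
  define d where "d = (1 - \<alpha>) / (1 + \<alpha>)"
  define C where "C = (1 - d) powr \<alpha>"
  define G where "G = fps_lin_powr 1 \<alpha> * fps_lin_powr d (- \<alpha>)"
  have d: "0 < d" "d < 1"
    using assms by (auto simp: d_def field_simps)
  hence C: "C > 0"
    by (simp add: C_def)
  have "Abs_fps \<omega> = fps_const C * G"
    using real_has_fps_expansion_unique[OF assms(3) sftr_fps_expansion] assms(1,2)
    by (simp add: C_def G_def d_def)
  hence \<omega>: "\<omega> n = C * fps_nth G n" for n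
    by (simp add: fps_eq_iff)

  \<comment> \<open>The shape shared by all three claims, with \<open>b\<close> equal to
    \<open>- \<alpha> - 1\<close>, \<open>- \<alpha> - 2\<close> and \<open>- \<alpha>\<close> in
    turn. Here \<alpha> < 1 makes the first exponent negative.\<close>
  have pos: "fps_nth (fps_lin_powr 1 (\<alpha> - 1) * fps_lin_powr d b) n > 0" if "b < 0" for b n
    using assms d that by (intro fps_mult_nth_pos fps_lin_powr_nth_pos) auto

  have neg: "\<omega> m < 0" if "m \<ge> 1" for m
  proof -
    obtain n where m: "m = Suc n"
      using \<open>m \<ge> 1\<close> by (metis Suc_le_D One_nat_def)
    have "real m * fps_nth G m = fps_nth (fps_deriv G) n"
      by (simp add: m)
    also have "\<dots> = - (\<alpha> * (1 - d) *
        fps_nth (fps_lin_powr 1 (\<alpha> - 1) * fps_lin_powr d (- \<alpha> - 1)) n)"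
      unfolding G_def fps_deriv_lin_powr_prod by simp
    also have "\<dots> < 0"
      using pos[of "- \<alpha> - 1" n] assms d by simp
    finally show ?thesis
      using C by (simp add: \<omega> mult_less_0_iff)
  qed

  have incr: "\<omega> m > \<omega> (m - 1)" if "m \<ge> 2" for m
  proof -
    define n where "n = m - 2"
    have m: "m = Suc (Suc n)"
      using that by (simp add: n_def)
    \<comment> \<open>Multiplication by \<open>1 - fps_X\<close> turns coefficients into backward
      differences, so the claim concerns the sign of those of \<open>H\<close>. Two derivatives
      shift the index by two, hence m \<ge> 2.\<close>
    define H where "H = (1 - fps_X) * G"
    have H: "H = fps_lin_powr 1 (\<alpha> + 1) * fps_lin_powr d (- \<alpha>)"
      using fps_lin_powr_add_1[of 1 \<alpha>] by (simp add: H_def G_def mult.assoc)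
    have "real (Suc n) * (real m * fps_nth H m) = fps_nth (fps_deriv (fps_deriv H)) n"
      by (simp add: m algebra_simps)
    also have "\<dots> = \<alpha> * (\<alpha> + 1) * (1 - d)\<^sup>2 *
        fps_nth (fps_lin_powr 1 (\<alpha> - 1) * fps_lin_powr d (- \<alpha> - 2)) n"
      unfolding H fps_deriv2_lin_powr_prod by simp
    also have "\<dots> > 0"
      using pos[of "- \<alpha> - 2" n] assms d by simp
    finally have "fps_nth H m > 0"
      by (simp add: zero_less_mult_iff m)
    moreover have "fps_nth H m = fps_nth G m - fps_nth G (m - 1)"
      by (simp add: H_def m left_diff_distrib)
    ultimately show ?thesis
      using C by (simp add: \<omega>)
  qed

  have sums: "(\<Sum>m=0..n. \<omega> m) > 0" for n
  proof -
    \<comment> \<open>This is \<open>G\<close> divided by \<open>1 - fps_X\<close>, so its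
      coefficients are the partial sums of those of \<open>G\<close>.\<close>
    define S where "S = fps_lin_powr 1 (\<alpha> - 1) * fps_lin_powr d (- \<alpha>)"
    have G: "G = (1 - fps_X) * S"
      using fps_lin_powr_add_1[of 1 "\<alpha> - 1"] by (simp add: G_def S_def mult.assoc)
    have "(\<Sum>m=0..n. \<omega> m) = C * fps_nth S n"
      by (induction n) (simp_all add: \<omega> G left_diff_distrib algebra_simps)
    thus ?thesis
      using C pos[of "- \<alpha>" n] assms by (simp add: S_def)
  qed

  show ?thesis
    \<comment> \<open>The sum up to 0 is \<open>\<omega> 0\<close> itself, which gives its
      positivity.\<close>
    using neg incr sums sums[of 0] by auto
qed

end
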